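(* Let $G$ be a finite abelian group such that the Schrijver–Seymour statement holds for $G$ and for every subgroup of $G$. Then $G$ is $(|G|-1)$-close.
   Context: Matroids are finite and loopless. For a matroid $M=(E,\mathcal{I})$ with rank function $r$ and a finite abelian group $K$, a $K$-labeling is a map $\ell:E\to K$, with $\ell(F)=\sum_{e\in F}\ell(e)$; let $\ell(M)=\{\ell(B): B \text{ a base of } M\}$, and for $S\subseteq K$ let $E(S)=\{e\in E:\ell(e)\in S\}$. The stabilizer of $S\subseteq K$ is $\mathrm{stab}(S)=\{h\in K: h+S=S\}$, a subgroup. The Schrijver–Seymour statement holds for $K$ if for every matroid $M$ and every $K$-labeling $\ell$, with $H=\mathrm{stab}(\ell(M))$, one has $|\ell(M)|\ge |H|\cdot\min\big\{\sum_{Q\in K/H} r(E(Q))-r(M)+1,\ |K|/|H|\big\}$, where the sum is over the cosets $Q$ of $H$. A $g$-base is a base $B$ with $\ell(B)=g$. A $G$-labeling $\ell$ of $M$ is $k$-close if for every $g\in G$ for which a $g$-base exists, every base $A$ has a $g$-base $B$ with $|A\setminus B|\le k$; $G$ is $k$-close if every $G$-labeling of every matroid is $k$-close. *)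

theory Defs
  imports Complex_Main "HOL-Algebra.Coset" "HOL-Algebra.FiniteProduct"
begin

locale loopless_matroid =
  fixes E :: "'e set" and \<I> :: "'e set set"
  assumes finite_ground: "finite E"
    and indep_subset_ground: "X \<in> \<I> \<Longrightarrow> X \<subseteq> E"
    and empty_indep: "{} \<in> \<I>"
    and indep_mono: "Y \<in> \<I> \<Longrightarrow> X \<subseteq> Y \<Longrightarrow> X \<in> \<I>"
    and augment: "X \<in> \<I> \<Longrightarrow> Y \<in> \<I> \<Longrightarrow> card X < card Y \<Longrightarrow> \<exists>y\<in>Y - X. insert y X \<in> \<I>"
    and loopless: "e \<in> E \<Longrightarrow> {e} \<in> \<I>"

definition rank :: "'e set set \<Rightarrow> 'e set \<Rightarrow> nat" where
  "rank \<I> X = Max (card ` {I \<in> \<I>. I \<subseteq> X})"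

definition bases :: "'e set set \<Rightarrow> 'e set set" where
  "bases \<I> = {B \<in> \<I>. \<forall>I\<in>\<I>. B \<subseteq> I \<longrightarrow> I = B}"

text \<open>
  Abelian groups are written multiplicatively, following the group locales, so the sum of the
  labels over a set is a \<^const>\<open>finprod\<close>.
\<close>

definition label :: "('g, 'm) monoid_scheme \<Rightarrow> ('e \<Rightarrow> 'g) \<Rightarrow> 'e set \<Rightarrow> 'g" where
  "label K l F = finprod K l F"

definition base_labels :: "('g, 'm) monoid_scheme \<Rightarrow> 'e set set \<Rightarrow> ('e \<Rightarrow> 'g) \<Rightarrow> 'g set" where
  "base_labels K \<I> l = label K l ` bases \<I>"

definition elems_labeled :: "'e set \<Rightarrow> ('e \<Rightarrow> 'g) \<Rightarrow> 'g set \<Rightarrow> 'e set" where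
  "elems_labeled E l S = {e \<in> E. l e \<in> S}"

definition stab :: "('g, 'm) monoid_scheme \<Rightarrow> 'g set \<Rightarrow> 'g set" where
  "stab K S = {h \<in> carrier K. h <#\<^bsub>K\<^esub> S = S}"

text \<open>
  A predicate cannot quantify over all types, so ``every matroid'' is relative to a type \<open>'e\<close> of
  potential ground set elements. Every finite matroid is isomorphic to one with ground set in
  \<^typ>\<open>nat\<close>, hence the instance \<open>'e = nat\<close> is the unrestricted notion.
\<close>

definition schrijver_seymour :: "'e itself \<Rightarrow> ('g, 'm) monoid_scheme \<Rightarrow> bool" where
  "schrijver_seymour TYPE('e) K \<longleftrightarrow>
    (\<forall>(E :: 'e set) \<I> l. loopless_matroid E \<I> \<longrightarrow> l \<in> E \<rightarrow> carrier K \<longrightarrow>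
      (let H = stab K (base_labels K \<I> l) in
        real (card (base_labels K \<I> l)) \<ge>
          real (card H) *
            min ((\<Sum>Q\<in>rcosets\<^bsub>K\<^esub> H. real (rank \<I> (elems_labeled E l Q)))
                   - real (rank \<I> E) + 1)
                (real (order K) / real (card H))))"

definition g_bases :: "('g, 'm) monoid_scheme \<Rightarrow> 'e set set \<Rightarrow> ('e \<Rightarrow> 'g) \<Rightarrow> 'g \<Rightarrow> 'e set set" where
  "g_bases K \<I> l g = {B \<in> bases \<I>. label K l B = g}"

definition close_labeling ::
    "('g, 'm) monoid_scheme \<Rightarrow> 'e set set \<Rightarrow> ('e \<Rightarrow> 'g) \<Rightarrow> nat \<Rightarrow> bool" where
  "close_labeling G \<I> l k \<longleftrightarrow>
    (\<forall>g\<in>carrier G. g_bases G \<I> l g \<noteq> {} \<longrightarrow>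
      (\<forall>A\<in>bases \<I>. \<exists>B\<in>g_bases G \<I> l g. card (A - B) \<le> k))"

definition close_group :: "'e itself \<Rightarrow> ('g, 'm) monoid_scheme \<Rightarrow> nat \<Rightarrow> bool" where
  "close_group TYPE('e) G k \<longleftrightarrow>
    (\<forall>(E :: 'e set) \<I> l. loopless_matroid E \<I> \<longrightarrow> l \<in> E \<rightarrow> carrier G \<longrightarrow>
      close_labeling G \<I> l k)"

end

theory Submission
  imports Defs
begin

text \<open>
  Let \<open>B\<close> be a \<open>g\<close>-base closest to \<open>A\<close>. Contracting \<open>A \<inter> B\<close> and restricting to the symmetric
  difference, it suffices to show: if the ground set is the disjoint union of two bases \<open>A\<close>, \<open>B\<close> of
  size \<open>r \<ge> |G|\<close>, then \<open>B\<close> is not the only base with its label.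

  Suppose it is, choose \<open>b \<in> B\<close>, and let \<open>H\<close> be the stabilizer of the label set of \<open>M - b\<close>, which
  misses \<open>\<ell>(B)\<close>. With \<open>m = |G/H|\<close>, the Schrijver--Seymour bound forces
  \<open>\<Sum>\<^sub>Q r(E(Q)) \<le> r + m - 1\<close>. By submodularity \<open>A(Q)\<close> has rank at least
  \<open>|A(Q)| + |B(Q)| - r(E(Q))\<close> after contracting \<open>B - B(Q)\<close>. These numbers add up to at least
  \<open>r - m + 1 > m (|H| - 1)\<close>, so for one of the \<open>m\<close> cosets the rank is at least \<open>|H|\<close>. Inside that
  coset, labels can be translated into \<open>H\<close>, and induction on the group order produces a second base.
\<close>

section \<open>Rank function and bases of a matroid\<close>

context loopless_matroid
begin

lemma finite_indep: "X \<in> \<I> \<Longrightarrow> finite X"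
  using finite_ground indep_subset_ground finite_subset by blast

lemma finite_\<I>: "finite \<I>"
  by (rule finite_subset[of _ "Pow E"]) (use indep_subset_ground finite_ground in auto)

lemma card_le_rank: "I \<in> \<I> \<Longrightarrow> I \<subseteq> X \<Longrightarrow> card I \<le> rank \<I> X"
  unfolding rank_def using finite_\<I> by (intro Max_ge) auto

lemma rank_attained: "\<exists>I\<in>\<I>. I \<subseteq> X \<and> card I = rank \<I> X"
proof -
  have "Max (card ` {I \<in> \<I>. I \<subseteq> X}) \<in> card ` {I \<in> \<I>. I \<subseteq> X}"
    using finite_\<I> empty_indep by (intro Max_in) auto
  then show ?thesis unfolding rank_def by auto
qed

lemma rank_indep: "I \<in> \<I> \<Longrightarrow> rank \<I> I = card I"
  using card_le_rank[of I I] rank_attained[of I] finite_indep card_mono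
  by (metis le_antisym order_refl)

lemma rank_mono: "X \<subseteq> Y \<Longrightarrow> rank \<I> X \<le> rank \<I> Y"
  using rank_attained[of X] card_le_rank by (metis order_trans)

lemma extend_indep:
  assumes "J \<in> \<I>" "J \<subseteq> X"
  shows "\<exists>I\<in>\<I>. J \<subseteq> I \<and> I \<subseteq> X \<and> card I = rank \<I> X"
  using assms
proof (induction "rank \<I> X - card J" arbitrary: J rule: less_induct)
  case less
  show ?case
  proof (cases "card J = rank \<I> X")
    case True
    then show ?thesis using less.prems by blast
  next
    case False
    then have lt: "card J < rank \<I> X" using card_le_rank less.prems by (simp add: le_neq_implies_less)
    obtain I where I: "I \<in> \<I>" "I \<subseteq> X" "card I = rank \<I> X" using rank_attained by blast
    then obtain y where y: "y \<in> I - J" "insert y J \<in> \<I>"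
      using augment less.prems lt by metis
    then have c: "card (insert y J) = Suc (card J)" using finite_indep less.prems by simp
    have "rank \<I> X - card (insert y J) < rank \<I> X - card J" using c lt by simp
    moreover have "insert y J \<subseteq> X" using y I less.prems by blast
    ultimately obtain I' where "I' \<in> \<I>" "insert y J \<subseteq> I'" "I' \<subseteq> X" "card I' = rank \<I> X"
      using less.hyps[of "insert y J"] y by blast
    then show ?thesis by blast
  qed
qed

lemma bases_iff_card: "B \<in> bases \<I> \<longleftrightarrow> B \<in> \<I> \<and> card B = rank \<I> E"
proof
  assume B: "B \<in> bases \<I>"
  then have "B \<in> \<I>" by (simp add: bases_def)
  then obtain I where "I \<in> \<I>" "B \<subseteq> I" "card I = rank \<I> E"
    using extend_indep indep_subset_ground by meson
  then show "B \<in> \<I> \<and> card B = rank \<I> E" using B by (auto simp: bases_def)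
next
  assume B: "B \<in> \<I> \<and> card B = rank \<I> E"
  show "B \<in> bases \<I>" unfolding bases_def
  proof (intro CollectI conjI ballI impI)
    show "B \<in> \<I>" using B by simp
    fix I assume I: "I \<in> \<I>" "B \<subseteq> I"
    then have "card I \<le> card B" using B card_le_rank indep_subset_ground by simp
    then show "I = B" using I finite_indep card_seteq by metis
  qed
qed

lemma base_indep: "B \<in> bases \<I> \<Longrightarrow> B \<in> \<I>"
  and card_base: "B \<in> bases \<I> \<Longrightarrow> card B = rank \<I> E"
  and base_subset_ground: "B \<in> bases \<I> \<Longrightarrow> B \<subseteq> E"
  using bases_iff_card indep_subset_ground by auto

lemma finite_base: "B \<in> bases \<I> \<Longrightarrow> finite B"
  using base_indep finite_indep by simp

text \<open>A largest independent subset \<open>I\<close> of the intersection extends to a largest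
  independent subset \<open>J\<close> of the union. Then \<open>J\<close> meets \<open>X\<close> and
  \<open>Y\<close> in independent sets whose common part contains \<open>I\<close>, and
  inclusion-exclusion finishes the count.\<close>

lemma rank_submodular: "rank \<I> (X \<union> Y) + rank \<I> (X \<inter> Y) \<le> rank \<I> X + rank \<I> Y"
proof -
  obtain I where I: "I \<in> \<I>" "I \<subseteq> X \<inter> Y" "card I = rank \<I> (X \<inter> Y)"
    using rank_attained by blast
  then obtain J where J: "J \<in> \<I>" "I \<subseteq> J" "J \<subseteq> X \<union> Y" "card J = rank \<I> (X \<union> Y)"
    using extend_indep[of I "X \<union> Y"] by auto
  have fJ: "finite J" using finite_indep J by simp
  have "card J + card I \<le> card ((J \<inter> X) \<union> (J \<inter> Y)) + card ((J \<inter> X) \<inter> (J \<inter> Y))"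
    using I J fJ by (intro add_mono card_mono) auto
  also have "\<dots> = card (J \<inter> X) + card (J \<inter> Y)"
    using card_Un_Int[of "J \<inter> X" "J \<inter> Y"] fJ by simp
  also have "\<dots> \<le> rank \<I> X + rank \<I> Y"
    using J indep_mono by (intro add_mono card_le_rank) auto
  finally show ?thesis using I J by simp
qed

lemma rank_le_card: "finite X \<Longrightarrow> rank \<I> X \<le> card X"
  using rank_attained card_mono by metis

end

section \<open>Minors and exchange between bases\<close>

text \<open>Contract \<open>C\<close>, then restrict to \<open>S\<close>; this is the usual minor only for independent \<open>C\<close>.\<close>

definition minor :: "'e set set \<Rightarrow> 'e set \<Rightarrow> 'e set \<Rightarrow> 'e set set" where
  "minor \<I> S C = {X. X \<subseteq> S \<and> X \<union> C \<in> \<I>}"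

context loopless_matroid
begin

text \<open>Augmentation is inherited by adding the disjoint set \<open>C\<close> to both sets. The
  condition on single elements of \<open>S\<close> is exactly what keeps contraction from creating
  loops.\<close>

lemma minor_matroid:
  assumes C: "C \<in> \<I>" and SC: "S \<inter> C = {}" and S: "\<And>e. e \<in> S \<Longrightarrow> insert e C \<in> \<I>"
  shows "loopless_matroid S (minor \<I> S C)"
proof
  have "S \<subseteq> E" using S indep_subset_ground by blast
  then show "finite S" using finite_ground finite_subset by blast
  show "X \<in> minor \<I> S C \<Longrightarrow> X \<subseteq> S" for X by (simp add: minor_def)
  show "{} \<in> minor \<I> S C" using C by (simp add: minor_def)
  show "X \<in> minor \<I> S C" if "Y \<in> minor \<I> S C" "X \<subseteq> Y" for X Y
    using that indep_mono[of "Y \<union> C" "X \<union> C"] by (auto simp: minor_def)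
  show "{e} \<in> minor \<I> S C" if "e \<in> S" for e using S that by (simp add: minor_def)
  fix X Y assume X: "X \<in> minor \<I> S C" and Y: "Y \<in> minor \<I> S C" and "card X < card Y"
  moreover have "finite (X \<union> C)" "finite (Y \<union> C)" using X Y finite_indep by (auto simp: minor_def)
  moreover have "X \<inter> C = {}" "Y \<inter> C = {}" using X Y SC by (auto simp: minor_def)
  ultimately have "card (X \<union> C) < card (Y \<union> C)" by (simp add: card_Un_disjoint)
  then obtain y where "y \<in> Y \<union> C - (X \<union> C)" "insert y (X \<union> C) \<in> \<I>"
    using augment[of "X \<union> C" "Y \<union> C"] X Y by (auto simp: minor_def)
  then show "\<exists>y\<in>Y - X. insert y X \<in> minor \<I> S C"
    using X Y by (intro bexI[of _ y]) (auto simp: minor_def)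
qed

text \<open>The witness \<open>X0\<close> shows that \<open>S\<close> together with \<open>C\<close>
  spans the matroid. Without such a witness, bases of the minor could fail to complete to bases of
  the whole matroid.\<close>

lemma bases_minor:
  assumes SC: "S \<inter> C = {}" and S: "\<And>e. e \<in> S \<Longrightarrow> insert e C \<in> \<I>"
    and X0: "X0 \<subseteq> S" "X0 \<union> C \<in> bases \<I>"
  shows "bases (minor \<I> S C) = {X. X \<subseteq> S \<and> X \<union> C \<in> bases \<I>}"
proof -
  have "C \<in> \<I>" using X0 base_indep indep_mono by blast
  then interpret N: loopless_matroid S "minor \<I> S C" using minor_matroid SC S by blast
  have card_Un: "card (X \<union> C) = card X + card C" if "X \<in> minor \<I> S C" for X
  proof -
    have "finite (X \<union> C)" "X \<inter> C = {}" using that finite_indep SC by (auto simp: minor_def)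
    then show ?thesis by (simp add: card_Un_disjoint)
  qed
  have X0N: "X0 \<in> minor \<I> S C" using X0 base_indep by (simp add: minor_def)
  \<comment> \<open>Knowing one base of the minor fixes its rank as
    \<open>rank \<I> E - card C\<close>; bases on both sides can then be compared by cardinality
    alone.\<close>
  have "X0 \<in> bases (minor \<I> S C)"
    unfolding bases_def
  proof (intro CollectI conjI ballI impI)
    fix I assume I: "I \<in> minor \<I> S C" "X0 \<subseteq> I"
    then have "I \<union> C \<in> \<I>" by (simp add: minor_def)
    moreover have "X0 \<union> C \<subseteq> I \<union> C" using I by blast
    ultimately have "I \<union> C = X0 \<union> C" using X0 unfolding bases_def by blast
    moreover have "I \<inter> C = {}" "X0 \<inter> C = {}" using I X0 SC by (auto simp: minor_def)
    ultimately show "I = X0" by blast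
  qed (fact X0N)
  then have "rank (minor \<I> S C) S + card C = rank \<I> E"
    using N.card_base card_Un[OF X0N] card_base[OF X0(2)] by simp
  then show ?thesis
    using card_Un by (auto simp: N.bases_iff_card bases_iff_card) (auto simp: minor_def)
qed

lemma rank_minor_delete:
  assumes "X \<subseteq> S"
  shows "rank (minor \<I> S {}) X = rank \<I> X"
proof -
  have "{I \<in> minor \<I> S {}. I \<subseteq> X} = {I \<in> \<I>. I \<subseteq> X}" using assms by (auto simp: minor_def)
  then show ?thesis by (simp add: rank_def)
qed

text \<open>The hypothesis says that \<open>A'\<close> has rank at least \<open>k\<close> in the contraction by \<open>Y\<close>.\<close>

lemma exchange_minor:
  assumes B: "B \<in> bases \<I>" and Y: "Y \<subseteq> B" and A': "A' \<subseteq> E" "A' \<inter> B = {}"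
    and k: "card Y + k \<le> rank \<I> (A' \<union> Y)"
  obtains A2 B2 where "A2 \<subseteq> A'" "B2 \<subseteq> B - Y" "k \<le> card A2" "A2 \<union> (B - B2) \<in> bases \<I>"
proof -
  have fB: "finite B" using finite_base B .
  have "Y \<in> \<I>" using B Y base_indep indep_mono by blast
  \<comment> \<open>First grow \<open>Y\<close> inside \<open>A' \<union> Y\<close> as far as
    possible, then complete the result \<open>I\<close> to a base \<open>D\<close> by elements of
    \<open>B\<close>. The elements of \<open>B\<close> missing from \<open>D\<close> lie outside
    \<open>Y\<close>, since \<open>Y\<close> is contained in \<open>I\<close>.\<close>
  then obtain I where I: "I \<in> \<I>" "Y \<subseteq> I" "I \<subseteq> A' \<union> Y" "card I = rank \<I> (A' \<union> Y)"
    using extend_indep[of Y "A' \<union> Y"] by auto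
  obtain D where D: "D \<in> \<I>" "I \<subseteq> D" "D \<subseteq> I \<union> B" "card D = rank \<I> (I \<union> B)"
    using extend_indep[of I "I \<union> B"] I by auto
  have "rank \<I> (I \<union> B) = rank \<I> E"
    using rank_mono[of B "I \<union> B"] rank_mono[of "I \<union> B" E] B I
      base_subset_ground[OF B] indep_subset_ground[OF I(1)] card_base[OF B] rank_indep[OF base_indep[OF B]]
    by auto
  then have Db: "D \<in> bases \<I>" using D bases_iff_card by simp
  have "I = Y \<union> (I - Y)" using I by blast
  then have "card I = card Y + card (I - Y)"
    using finite_indep[OF I(1)] I(2) by (metis card_Diff_subset card_mono finite_subset le_add_diff_inverse)
  then have "k \<le> card (I - Y)" using I k by simp
  moreover have "(I - Y) \<union> (B - (B - D)) = D" using I D Y by blast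
  moreover have "B - D \<subseteq> B - Y" using I D by blast
  ultimately show ?thesis using that[of "I - Y" "B - D"] Db I by auto
qed

end

text \<open>Each element of \<open>A \<union> B\<close> lies in a base containing \<open>C\<close>,
  so contracting \<open>C\<close> leaves no loop among them. This is the form in which both later
  reductions use minors.\<close>

lemma minor_matroid_bases:
  assumes "loopless_matroid E \<I>" and AC: "A \<union> C \<in> bases \<I>" and BC: "B \<union> C \<in> bases \<I>"
    and disj: "(A \<union> B) \<inter> C = {}"
  shows "loopless_matroid (A \<union> B) (minor \<I> (A \<union> B) C)"
    and "bases (minor \<I> (A \<union> B) C) = {X. X \<subseteq> A \<union> B \<and> X \<union> C \<in> bases \<I>}"
proof -
  interpret loopless_matroid E \<I> by fact
  have S: "insert e C \<in> \<I>" if "e \<in> A \<union> B" for e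
    using that AC BC base_indep indep_mono[of "A \<union> C" "insert e C"] indep_mono[of "B \<union> C" "insert e C"]
    by blast
  have "C \<in> \<I>" using AC base_indep indep_mono by blast
  then show "loopless_matroid (A \<union> B) (minor \<I> (A \<union> B) C)"
    using minor_matroid disj S by blast
  show "bases (minor \<I> (A \<union> B) C) = {X. X \<subseteq> A \<union> B \<and> X \<union> C \<in> bases \<I>}"
    using bases_minor[OF disj S _ AC] by blast
qed


section \<open>Renaming the ground set\<close>

lemma (in loopless_matroid) image_matroid:
  assumes f: "inj_on f E"
  shows "loopless_matroid (f ` E) ((`) f ` \<I>)"
proof
  show "finite (f ` E)" using finite_ground by simp
  show "X \<in> (`) f ` \<I> \<Longrightarrow> X \<subseteq> f ` E" for X using indep_subset_ground by blast
  show "{} \<in> (`) f ` \<I>" using empty_indep by auto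
  show "X \<in> (`) f ` \<I>" if "Y \<in> (`) f ` \<I>" "X \<subseteq> Y" for X Y
    using that indep_mono by (metis (no_types, lifting) image_iff subset_image_iff)
  show "{e} \<in> (`) f ` \<I>" if "e \<in> f ` E" for e
    using that loopless by (metis (no_types, lifting) image_empty image_iff image_insert)
  fix X Y assume "X \<in> (`) f ` \<I>" "Y \<in> (`) f ` \<I>" "card X < card Y"
  then obtain X' Y' where X': "X' \<in> \<I>" "X = f ` X'" and Y': "Y' \<in> \<I>" "Y = f ` Y'"
    and lt: "card (f ` X') < card (f ` Y')" by auto
  have "inj_on f X'" "inj_on f Y'" using f X' Y' indep_subset_ground inj_on_subset by blast+
  then have "card X' < card Y'" using lt by (simp add: card_image)
  then obtain y where y: "y \<in> Y' - X'" "insert y X' \<in> \<I>" using augment X' Y' by blast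
  have "f y \<notin> f ` X'"
    using f y X' Y' indep_subset_ground by (auto dest!: inj_onD)
  moreover have "insert (f y) X \<in> (`) f ` \<I>" using y X' by (metis image_eqI image_insert)
  ultimately show "\<exists>y\<in>Y - X. insert y X \<in> (`) f ` \<I>" using y X' Y' by blast
qed

lemma (in loopless_matroid) rank_image:
  assumes f: "inj_on f E" and X: "X \<subseteq> E"
  shows "rank ((`) f ` \<I>) (f ` X) = rank \<I> X"
proof -
  have "card ` {I \<in> (`) f ` \<I>. I \<subseteq> f ` X} = card ` {I \<in> \<I>. I \<subseteq> X}" (is "?L = ?R")
  proof -
    have "{I \<in> (`) f ` \<I>. I \<subseteq> f ` X} = (`) f ` {I \<in> \<I>. I \<subseteq> X}"
    proof -
      have "f ` I \<subseteq> f ` X \<longleftrightarrow> I \<subseteq> X" if "I \<in> \<I>" for I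
        using f X indep_subset_ground[OF that] unfolding inj_on_def by blast
      then show ?thesis by blast
    qed
    then have "?L = (\<lambda>I. card (f ` I)) ` {I \<in> \<I>. I \<subseteq> X}" by (simp add: image_image)
    also have "\<dots> = ?R"
      using f X by (intro image_cong refl card_image) (auto intro: inj_on_subset)
    finally show ?thesis .
  qed
  then show ?thesis by (simp add: rank_def)
qed

lemma (in loopless_matroid) bases_image:
  assumes f: "inj_on f E"
  shows "bases ((`) f ` \<I>) = (`) f ` bases \<I>"
proof -
  interpret N: loopless_matroid "f ` E" "(`) f ` \<I>" using image_matroid f .
  have "card (f ` I) = card I" if "I \<in> \<I>" for I
    using f that indep_subset_ground by (intro card_image) (auto intro: inj_on_subset)
  then show ?thesis
    using rank_image[OF f order_refl] by (auto simp: N.bases_iff_card bases_iff_card)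
qed

text \<open>A finite ground set injects into \<open>nat\<close>, and every quantity in the
  inequality is invariant under renaming elements: the set of base labels, hence its stabilizer, and
  all the ranks.\<close>

lemma schrijver_seymour_any_type:
  assumes "comm_monoid K" and SS: "schrijver_seymour TYPE(nat) K"
  shows "schrijver_seymour TYPE('e) K"
  unfolding schrijver_seymour_def
proof (intro allI impI)
  fix E :: "'e set" and \<I> l
  assume M: "loopless_matroid E \<I>" and l: "l \<in> E \<rightarrow> carrier K"
  interpret comm_monoid K by fact
  interpret loopless_matroid E \<I> by fact
  obtain f :: "'e \<Rightarrow> nat" where f: "inj_on f E"
    using finite_imp_inj_to_nat_seg[OF finite_ground] by blast
  define l' where "l' = l \<circ> inv_into E f"
  have l'f: "l' (f e) = l e" if "e \<in> E" for e using f that by (simp add: l'_def)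
  have l': "l' \<in> f ` E \<rightarrow> carrier K" using l l'f by auto
  have el: "elems_labeled (f ` E) l' Q = f ` elems_labeled E l Q" for Q
    using l'f by (auto simp: elems_labeled_def)
  have "label K l' (f ` B) = label K l B" if "B \<in> bases \<I>" for B
  proof -
    have BE: "B \<subseteq> E" using that base_subset_ground by simp
    then have "finprod K l' (f ` B) = finprod K (\<lambda>x. l' (f x)) B"
      using f l' by (intro finprod_reindex) (auto intro: inj_on_subset)
    also have "\<dots> = finprod K l B"
      using BE l l'f by (intro finprod_cong') auto
    finally show ?thesis by (simp add: label_def)
  qed
  then have bl: "base_labels K ((`) f ` \<I>) l' = base_labels K \<I> l"
    by (simp add: base_labels_def bases_image[OF f] image_image)
  have rk: "rank ((`) f ` \<I>) (elems_labeled (f ` E) l' Q) = rank \<I> (elems_labeled E l Q)" for Q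
    unfolding el by (rule rank_image[OF f]) (auto simp: elems_labeled_def)
  show "let H = stab K (base_labels K \<I> l) in
        real (card (base_labels K \<I> l)) \<ge>
          real (card H) *
            min ((\<Sum>Q\<in>rcosets\<^bsub>K\<^esub> H. real (rank \<I> (elems_labeled E l Q)))
                   - real (rank \<I> E) + 1)
                (real (order K) / real (card H))"
    using SS[unfolded schrijver_seymour_def, rule_format, OF image_matroid[OF f] l']
    unfolding bl rk rank_image[OF f order_refl] .
qed

section \<open>Subgroups and stabilizers\<close>

lemma (in comm_group) subgroup_is_comm_group:
  assumes "subgroup H G"
  shows "comm_group (G\<lparr>carrier := H\<rparr>)"
proof -
  interpret S: group "G\<lparr>carrier := H\<rparr>" using assms subgroup_imp_group by blast
  show ?thesis
    using subgroup.subset[OF assms] by (intro S.group_comm_groupI) (auto intro: m_comm)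
qed

lemma (in comm_group) finprod_subgroup:
  assumes H: "subgroup H G" and "f \<in> A \<rightarrow> H"
  shows "finprod (G\<lparr>carrier := H\<rparr>) f A = finprod G f A"
proof -
  interpret S: comm_group "G\<lparr>carrier := H\<rparr>" using subgroup_is_comm_group H .
  show ?thesis using assms(2)
  proof (induction A rule: infinite_finite_induct)
    case (insert a A)
    then have "f \<in> A \<rightarrow> carrier (G\<lparr>carrier := H\<rparr>)" "f a \<in> H" by auto
    moreover have "f \<in> A \<rightarrow> carrier G" "f a \<in> carrier G"
      using insert.prems subgroup.subset[OF H] by auto
    ultimately show ?case using insert by simp
  next
    case empty
    show ?case using S.finprod_empty by simp
  \<comment> \<open>Over an infinite index set both products are the identity by convention.\<close>
  qed (simp add: finprod_def)
qed

lemma (in group) stab_subgroup: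
  assumes "S \<subseteq> carrier G"
  shows "subgroup (stab G S) G"
proof (rule subgroupI)
  show "stab G S \<subseteq> carrier G" by (auto simp: stab_def)
  have "\<one> \<in> stab G S" using assms lcos_mult_one by (simp add: stab_def)
  then show "stab G S \<noteq> {}" by blast
  fix a assume a: "a \<in> stab G S"
  then have ac: "a \<in> carrier G" and "inv a <# S = inv a <# (a <# S)" by (simp_all add: stab_def)
  note this(2)
  also have "inv a <# (a <# S) = S" using ac assms by (simp add: lcos_m_assoc lcos_mult_one)
  finally show "inv a \<in> stab G S" using a unfolding stab_def by simp
  fix b assume "b \<in> stab G S"
  with a have ab: "a \<in> carrier G" "b \<in> carrier G" "a <# S = S" "b <# S = S"
    by (simp_all add: stab_def)
  then have "(a \<otimes> b) <# S = S" using lcos_m_assoc[OF assms ab(1,2)] by metis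
  then show "a \<otimes> b \<in> stab G S" using ab by (simp add: stab_def)
qed

text \<open>Translations act transitively: \<open>g \<otimes> inv s\<close> moves \<open>s\<close>
  to \<open>g\<close>. This later makes the stabilizer a proper subgroup, so that the induction
  descends.\<close>

lemma (in group) stab_eq_carrier:
  assumes S: "S \<subseteq> carrier G" "S \<noteq> {}" and stab: "stab G S = carrier G"
  shows "S = carrier G"
proof -
  obtain s where s: "s \<in> S" using S by blast
  have "g \<in> S" if g: "g \<in> carrier G" for g
  proof -
    have sc: "s \<in> carrier G" using s S by blast
    then have "g \<otimes> inv s \<in> stab G S" using stab g by simp
    then have "(g \<otimes> inv s) <# S = S" by (simp add: stab_def)
    moreover have "(g \<otimes> inv s) \<otimes> s \<in> (g \<otimes> inv s) <# S" using s by (auto simp: l_coset_def)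
    ultimately show ?thesis using g sc by (simp add: m_assoc)
  qed
  then show ?thesis using S by blast
qed

section \<open>Counting over cosets\<close>

lemma (in group) sum_card_elems_labeled:
  assumes fin: "finite (carrier G)" "finite X" and H: "subgroup H G" and l: "l \<in> X \<rightarrow> carrier G"
  shows "(\<Sum>Q\<in>rcosets H. card (elems_labeled X l Q)) = card X"
proof -
  have un: "\<Union>(rcosets H) = carrier G" using rcosets_part_G H .
  have "finite (rcosets H)" using un fin finite_UnionD by metis
  moreover have "elems_labeled X l P \<inter> elems_labeled X l Q = {}"
    if "P \<in> rcosets H" "Q \<in> rcosets H" "P \<noteq> Q" for P Q
    using rcos_disjoint[OF H] that by (auto simp: elems_labeled_def pairwise_def disjnt_def)
  ultimately have "card (\<Union>Q\<in>rcosets H. elems_labeled X l Q) = (\<Sum>Q\<in>rcosets H. card (elems_labeled X l Q))"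
    using fin by (intro card_UN_disjoint) (auto simp: elems_labeled_def)
  moreover have "(\<Union>Q\<in>rcosets H. elems_labeled X l Q) = {e \<in> X. l e \<in> \<Union>(rcosets H)}"
    by (auto simp: elems_labeled_def)
  moreover have "\<dots> = X" unfolding un using l by auto
  ultimately show ?thesis by simp
qed


text \<open>The conclusion is the hypothesis of \<open>exchange_minor\<close> for \<open>Y\<close>
  the part of \<open>B\<close> outside the coset and \<open>k = card H\<close>. Properness of
  \<open>H\<close> provides the smaller group for the induction.\<close>

lemma (in comm_group) large_coset_rank:
  fixes E :: "'e set"
  assumes fin: "finite (carrier G)" and SS: "schrijver_seymour TYPE('e) G"
    and M: "loopless_matroid E \<I>" and A: "A \<in> bases \<I>" and B: "B \<in> bases \<I>"
    and AB: "A \<union> B = E" "A \<inter> B = {}" and l: "l \<in> E \<rightarrow> carrier G"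
    and ord: "order G \<le> card A"
    and unique: "\<And>D. D \<in> bases \<I> \<Longrightarrow> label G l D = label G l B \<Longrightarrow> D = B"
  obtains H Q where "subgroup H G" "H \<noteq> carrier G" "Q \<in> rcosets H"
    "card (B - elems_labeled B l Q) + card H \<le> rank \<I> (elems_labeled A l Q \<union> (B - elems_labeled B l Q))"
proof -
  interpret loopless_matroid E \<I> by fact
  define r where "r = rank \<I> E"
  have cA: "card A = r" and cB: "card B = r" using A B card_base r_def by auto
  have fA: "finite A" and fB: "finite B" using A B finite_base by auto
  have lA: "l \<in> A \<rightarrow> carrier G" and lB: "l \<in> B \<rightarrow> carrier G" using l AB by auto
  have "order G > 0" using fin order_gt_0_iff_finite by simp
  then obtain b where b: "b \<in> B" using ord cA cB by fastforce
  then have bA: "b \<notin> A" "A \<subseteq> E - {b}" using AB by auto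
  define \<J> where "\<J> = minor \<I> (E - {b}) {}"
  have E_b: "insert e {} \<in> \<I>" if "e \<in> E - {b}" for e using loopless that by simp
  have MJ: "loopless_matroid (E - {b}) \<J>"
    unfolding \<J>_def using minor_matroid[OF empty_indep _ E_b] by blast
  have basesJ: "bases \<J> = {X. X \<subseteq> E - {b} \<and> X \<in> bases \<I>}"
    unfolding \<J>_def using bases_minor[of "E - {b}" "{}" A] E_b bA A by simp
  have rankJ: "rank \<J> X = rank \<I> X" if "X \<subseteq> E - {b}" for X
    unfolding \<J>_def using rank_minor_delete that .
  \<comment> \<open>Deleting \<open>b\<close> keeps the rank, because the base \<open>A\<close>
    survives.\<close>
  have rE: "rank \<J> (E - {b}) = r"
    using rankJ rank_mono[of A "E - {b}"] rank_mono[of "E - {b}" E] bA cA rank_indep[OF base_indep[OF A]]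
    by (simp add: r_def)
  define L where "L = base_labels G \<J> l"
  have Lc: "L \<subseteq> carrier G"
    using l basesJ by (fastforce simp: L_def base_labels_def label_def intro: finprod_closed)
  have Lne: "L \<noteq> {}" using A bA basesJ by (auto simp: L_def base_labels_def)
  \<comment> \<open>A base of the deletion avoids \<open>b\<close>, hence differs from
    \<open>B\<close>, and uniqueness of \<open>B\<close> applies.\<close>
  have "label G l B \<notin> L"
    using unique b basesJ by (auto simp: L_def base_labels_def)
  moreover have "label G l B \<in> carrier G" using lB by (simp add: label_def)
  ultimately have Llt: "L \<noteq> carrier G" "card L < order G"
    using Lc fin by (auto simp: order_def intro: psubset_card_mono)
  define H where "H = stab G L"
  have H: "subgroup H G" unfolding H_def using stab_subgroup Lc .
  have Hne: "H \<noteq> carrier G" using stab_eq_carrier Lc Lne Llt by (auto simp: H_def)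
  have "finite H" using H fin subgroup.subset finite_subset by metis
  then have H0: "card H > 0" using subgroup.one_closed[OF H] card_gt_0_iff by blast
  define m where "m = card (rcosets H)"
  have mH: "m * card H = order G" unfolding m_def using lagrange H .
  define EQ where "EQ = elems_labeled E l"
  define AQ where "AQ = elems_labeled A l"
  define BQ where "BQ = elems_labeled B l"
  have EQb: "elems_labeled (E - {b}) l Q = EQ Q - elems_labeled {b} l Q" for Q
    by (auto simp: EQ_def elems_labeled_def)
  have EQsub: "EQ Q - elems_labeled {b} l Q \<subseteq> E - {b}" for Q
    by (auto simp: EQ_def elems_labeled_def)
  define R where "R = (\<Sum>Q\<in>rcosets H. rank \<I> (EQ Q - elems_labeled {b} l Q))"
  have "real (card L) \<ge> real (card H) * min (real R - real r + 1) (real (order G) / real (card H))"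
  proof -
    have "l \<in> E - {b} \<rightarrow> carrier G" using l by auto
    from SS[unfolded schrijver_seymour_def, rule_format, OF MJ this] show ?thesis
      unfolding L_def[symmetric] H_def[symmetric] Let_def EQb rE rankJ[OF EQsub] R_def by simp
  qed
  moreover have "real (card H) * (real (order G) / real (card H)) = real (order G)" using H0 by simp
  \<comment> \<open>Since \<open>card L < order G\<close>, the minimum cannot be attained by the
    term \<open>order G / card H\<close>, so the rank sum is the term that matters.\<close>
  ultimately have "real (card H) * (real R - real r + 1) < real (order G)"
    using Llt(2) by (auto simp: min_def split: if_splits)
  also have "\<dots> = real (card H) * real m" using mH by (metis mult.commute of_nat_mult)
  finally have "real R - real r + 1 < real m" using H0 by simp
  \<comment> \<open>Strictness between integers gains one here; this unit and the \<open>1\<close>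
    later paid for restoring \<open>b\<close> make the final count tight.\<close>
  then have Rm: "R + 2 \<le> m + r" by linarith
  have "\<exists>Q\<in>rcosets H. card (B - BQ Q) + card H \<le> rank \<I> (AQ Q \<union> (B - BQ Q))"
  proof (rule ccontr)
    assume neg: "\<not> ?thesis"
    have le: "card (AQ Q) + card (BQ Q) \<le>
        rank \<I> (EQ Q - elems_labeled {b} l Q) + card (elems_labeled {b} l Q) + (card H - 1)"
      if Q: "Q \<in> rcosets H" for Q
    proof -
      \<comment> \<open>Submodularity is applied to these two sets: their union spans because it
        contains the base \<open>B\<close>, and their intersection contains the independent set
        \<open>AQ Q\<close>.\<close>
      have un: "(AQ Q \<union> (B - BQ Q)) \<union> EQ Q \<supseteq> B"
        and int: "(AQ Q \<union> (B - BQ Q)) \<inter> EQ Q \<supseteq> AQ Q"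
        using AB by (auto simp: AQ_def BQ_def EQ_def elems_labeled_def)
      have "AQ Q \<in> \<I>"
        using base_indep[OF A] by (rule indep_mono) (auto simp: AQ_def elems_labeled_def)
      then have "r + card (AQ Q) = rank \<I> B + rank \<I> (AQ Q)"
        using rank_indep base_indep[OF B] cB by simp
      also have "\<dots> \<le> rank \<I> (AQ Q \<union> (B - BQ Q)) + rank \<I> (EQ Q)"
        using rank_mono[OF un] rank_mono[OF int] rank_submodular[of "AQ Q \<union> (B - BQ Q)" "EQ Q"]
        by linarith
      finally have 1: "r + card (AQ Q) \<le> rank \<I> (AQ Q \<union> (B - BQ Q)) + rank \<I> (EQ Q)" .
      \<comment> \<open>Putting \<open>b\<close> back raises the rank by at most one, and only in
        the coset of its label; summed over all cosets the cost is \<open>1\<close>.\<close>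
      have "EQ Q \<subseteq> (EQ Q - elems_labeled {b} l Q) \<union> elems_labeled {b} l Q" by blast
      then have "rank \<I> (EQ Q) \<le> rank \<I> (EQ Q - elems_labeled {b} l Q) + rank \<I> (elems_labeled {b} l Q)"
        using rank_mono rank_submodular[of "EQ Q - elems_labeled {b} l Q" "elems_labeled {b} l Q"]
        by (meson add_leD1 order_trans)
      moreover have "rank \<I> (elems_labeled {b} l Q) \<le> card (elems_labeled {b} l Q)"
        by (rule rank_le_card) (auto simp: elems_labeled_def)
      ultimately have 2: "rank \<I> (EQ Q) \<le>
          rank \<I> (EQ Q - elems_labeled {b} l Q) + card (elems_labeled {b} l Q)" by simp
      have "BQ Q \<subseteq> B" by (auto simp: BQ_def elems_labeled_def)
      then have 3: "card (B - BQ Q) + card (BQ Q) = r"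
        using fB cB by (metis card_Diff_subset card_mono finite_subset le_add_diff_inverse2)
      have "rank \<I> (AQ Q \<union> (B - BQ Q)) < card (B - BQ Q) + card H" using neg Q by auto
      then show ?thesis using 1 2 3 by linarith
    qed
    have "r + r = (\<Sum>Q\<in>rcosets H. card (AQ Q) + card (BQ Q))"
      using sum_card_elems_labeled[OF fin fA H lA] sum_card_elems_labeled[OF fin fB H lB] cA cB
      by (simp add: sum.distrib AQ_def BQ_def)
    also have "\<dots> \<le> (\<Sum>Q\<in>rcosets H. rank \<I> (EQ Q - elems_labeled {b} l Q)
        + card (elems_labeled {b} l Q) + (card H - 1))"
      using le by (rule sum_mono)
    also have "\<dots> = R + 1 + m * (card H - 1)"
      using sum_card_elems_labeled[of "{b}" H l] fin H funcset_mem[OF lB b] by (simp add: sum.distrib R_def m_def)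
    \<comment> \<open>Adding \<open>m\<close> to both sides removes the truncated subtraction and
      turns the last term into \<open>m * card H = order G\<close>, which is at most
      \<open>r\<close>. What remains is \<open>r + m \<le> R + 1\<close>, against
      \<open>Rm\<close>.\<close>
    finally have "r + r + m \<le> R + 1 + (m * (card H - 1) + m)" by simp
    also have "m * (card H - 1) + m = m * card H" using H0 by (cases "card H") auto
    finally show False using Rm ord cA mH by linarith
  qed
  then show ?thesis using that[OF H Hne] by (auto simp: AQ_def BQ_def)
qed

section \<open>Induction on the group order\<close>

text \<open>A matroid version of the bound \<open>|G|\<close> for the Davenport constant.\<close>

lemma second_base_same_label:
  fixes G :: "('g, 'm) monoid_scheme" and E :: "'e set"
  assumes "comm_group G" "finite (carrier G)"
    and "\<And>H. subgroup H G \<Longrightarrow> schrijver_seymour TYPE('e) (G\<lparr>carrier := H\<rparr>)"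
    and "loopless_matroid E \<I>" "A \<in> bases \<I>" "B \<in> bases \<I>" "A \<union> B = E" "A \<inter> B = {}"
    and "l \<in> E \<rightarrow> carrier G" "order G \<le> card A"
  shows "\<exists>D\<in>bases \<I>. D \<noteq> B \<and> label G l D = label G l B"
  using assms
proof (induction "order G" arbitrary: G E \<I> A B l rule: less_induct)
  case (less G E \<I> A B l)
  interpret comm_group G by fact
  interpret loopless_matroid E \<I> by fact
  note A = less.prems(5) and B = less.prems(6) and AB = less.prems(7,8) and l = less.prems(9)
  have fA: "finite A" and fB: "finite B" using A B finite_base by auto
  show ?case
  proof (rule ccontr)
    assume contr: "\<not> ?case"
    have "schrijver_seymour TYPE('e) G" using less.prems(3)[OF subgroup_self] by simp
    \<comment> \<open>The trivial group is covered as well: it has no proper subgroup, so obtaining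
      \<open>H\<close> is then already contradictory.\<close>
    then obtain H Q where H: "subgroup H G" "H \<noteq> carrier G" and Q: "Q \<in> rcosets\<^bsub>G\<^esub> H" and
      rk: "card (B - elems_labeled B l Q) + card H
          \<le> rank \<I> (elems_labeled A l Q \<union> (B - elems_labeled B l Q))"
      using large_coset_rank[OF less.prems(2) _ less.prems(4-10)] contr by metis
    obtain x where x: "x \<in> carrier G" "Q = H #>\<^bsub>G\<^esub> x" using Q by (auto simp: RCOSETS_def)
    obtain A2 B2 where A2: "A2 \<subseteq> elems_labeled A l Q"
      and B2': "B2 \<subseteq> B - (B - elems_labeled B l Q)"
      and cA2: "card H \<le> card A2" and A2B: "A2 \<union> (B - B2) \<in> bases \<I>"
      using exchange_minor[OF B Diff_subset _ _ rk] AB by (auto simp: elems_labeled_def)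
    have B2: "B2 \<subseteq> elems_labeled B l Q" using B2' by blast
    define C where "C = B - B2"
    have subs: "A2 \<subseteq> A" "B2 \<subseteq> B" using A2 B2 by (auto simp: elems_labeled_def)
    have BC: "B2 \<union> C = B" and disj: "(A2 \<union> B2) \<inter> C = {}"
      using subs AB by (auto simp: C_def)
    have A2C: "A2 \<union> C \<in> bases \<I>" and B2C: "B2 \<union> C \<in> bases \<I>"
      using A2B B BC by (simp_all add: C_def)
    note N = minor_matroid_bases[OF less.prems(4) A2C B2C disj]
    interpret N: loopless_matroid "A2 \<union> B2" "minor \<I> (A2 \<union> B2) C" by (rule N(1))
    have lQ: "l e \<in> Q" if "e \<in> A2 \<union> B2" for e
      using that A2 B2 by (auto simp: elems_labeled_def)
    \<comment> \<open>Dividing by the coset representative \<open>x\<close> moves all labels from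
      \<open>Q\<close> into \<open>H\<close>.\<close>
    define l' where "l' e = l e \<otimes>\<^bsub>G\<^esub> inv\<^bsub>G\<^esub> x" for e
    have l'H: "l' \<in> A2 \<union> B2 \<rightarrow> H"
    proof (rule funcsetI)
      fix e assume "e \<in> A2 \<union> B2"
      then obtain h where "h \<in> H" "l e = h \<otimes>\<^bsub>G\<^esub> x" using lQ x by (auto simp: r_coset_def)
      then show "l' e \<in> H"
        using x subgroup.mem_carrier[OF H(1)] by (simp add: l'_def m_assoc)
    qed
    have "H \<subset> carrier G" using H subgroup.subset by blast
    then have lt: "order (G\<lparr>carrier := H\<rparr>) < order G" and fH: "finite H"
      using less.prems(2) by (auto simp: order_def psubset_card_mono finite_subset)
    have "\<exists>D\<in>bases (minor \<I> (A2 \<union> B2) C). D \<noteq> B2 \<and>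
        label (G\<lparr>carrier := H\<rparr>) l' D = label (G\<lparr>carrier := H\<rparr>) l' B2"
    proof (rule less.hyps[OF lt])
      show "comm_group (G\<lparr>carrier := H\<rparr>)" using subgroup_is_comm_group H by blast
      show "finite (carrier (G\<lparr>carrier := H\<rparr>))" using fH by simp
      show "schrijver_seymour TYPE('e) (G\<lparr>carrier := H\<rparr>\<lparr>carrier := H'\<rparr>)"
        if "subgroup H' (G\<lparr>carrier := H\<rparr>)" for H'
        using less.prems(3)[OF incl_subgroup[OF H(1) that]] by simp
      show "loopless_matroid (A2 \<union> B2) (minor \<I> (A2 \<union> B2) C)" by (rule N(1))
      show "A2 \<in> bases (minor \<I> (A2 \<union> B2) C)" "B2 \<in> bases (minor \<I> (A2 \<union> B2) C)"
        using N(2) A2C B2C by auto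
      show "A2 \<union> B2 = A2 \<union> B2" "A2 \<inter> B2 = {}" using subs AB by auto
      show "l' \<in> A2 \<union> B2 \<rightarrow> carrier (G\<lparr>carrier := H\<rparr>)" using l'H by simp
      show "order (G\<lparr>carrier := H\<rparr>) \<le> card A2" using cA2 by (simp add: order_def)
    qed
    then obtain D where D: "D \<in> bases (minor \<I> (A2 \<union> B2) C)" "D \<noteq> B2"
      and lab: "finprod (G\<lparr>carrier := H\<rparr>) l' D = finprod (G\<lparr>carrier := H\<rparr>) l' B2"
      unfolding label_def by blast
    have D': "D \<subseteq> A2 \<union> B2" "D \<union> C \<in> bases \<I>" using D N(2) by auto
    have lc: "l \<in> A2 \<union> B2 \<union> C \<rightarrow> carrier G" using l AB subs by (auto simp: C_def)
    have l'c: "l' \<in> A2 \<union> B2 \<rightarrow> carrier G" using l'H subgroup.subset[OF H(1)] by auto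
    \<comment> \<open>The translation changes the label of \<open>X\<close> only by a power of
      \<open>x\<close> depending on \<open>card X\<close>. Bases have equal size, so equality of
      labels passes between \<open>l'\<close> and \<open>l\<close>.\<close>
    have shift: "finprod G l X = finprod G l' X \<otimes>\<^bsub>G\<^esub> x [^]\<^bsub>G\<^esub> card X" if X: "X \<subseteq> A2 \<union> B2" for X
    proof -
      have "finprod G l X = finprod G (\<lambda>e. l' e \<otimes>\<^bsub>G\<^esub> x) X"
        using X lc l'c x by (intro finprod_cong') (auto simp: l'_def m_assoc Pi_iff)
      also have "\<dots> = finprod G l' X \<otimes>\<^bsub>G\<^esub> finprod G (\<lambda>_. x) X"
        using X l'c x by (intro finprod_multf) auto
      finally show ?thesis using x by (simp add: finprod_const)
    qed
    have B2N: "B2 \<in> bases (minor \<I> (A2 \<union> B2) C)" using N(2) B2C by auto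
    have "finprod G l' D = finprod G l' B2"
      using lab finprod_subgroup[OF H(1), of l' D] finprod_subgroup[OF H(1), of l' B2] l'H D'(1)
      by (auto simp: Pi_iff subset_iff)
    then have lDB: "finprod G l D = finprod G l B2"
      using shift D' N.card_base[OF D(1)] N.card_base[OF B2N] by simp
    have split: "label G l (X \<union> C) = finprod G l X \<otimes>\<^bsub>G\<^esub> finprod G l C" if X: "X \<subseteq> A2 \<union> B2" for X
      unfolding label_def
    proof (rule finprod_Un_disjoint)
      show "finite X" using X N.finite_ground finite_subset by blast
      show "finite C" using fB by (simp add: C_def)
      show "X \<inter> C = {}" using X disj by blast
      show "l \<in> X \<rightarrow> carrier G" "l \<in> C \<rightarrow> carrier G" using X lc by auto
    qed
    have "label G l (D \<union> C) = label G l B"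
      using split[OF D'(1)] split[of B2] BC lDB by simp
    moreover have "D \<union> C \<noteq> B" using D(2) D'(1) disj BC by blast
    ultimately show False using contr D' by blast
  qed
qed

section \<open>Reduction to two disjoint bases\<close>

theorem theorem4:
  fixes G :: "('g, 'm) monoid_scheme"
  assumes "comm_group G" and "finite (carrier G)"
    and "schrijver_seymour TYPE(nat) G"
    and "\<And>H. subgroup H G \<Longrightarrow> schrijver_seymour TYPE(nat) (G\<lparr>carrier := H\<rparr>)"
  shows "close_group TYPE('e) G (order G - 1)"
  unfolding close_group_def close_labeling_def
proof (intro allI impI ballI)
  fix E :: "'e set" and \<I> l g A
  assume M: "loopless_matroid E \<I>" and l: "l \<in> E \<rightarrow> carrier G"
    and g: "g_bases G \<I> l g \<noteq> {}" and A: "A \<in> bases \<I>"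
  interpret comm_group G by fact
  interpret loopless_matroid E \<I> by fact
  have SS: "schrijver_seymour TYPE('e) (G\<lparr>carrier := H\<rparr>)" if "subgroup H G" for H
    using schrijver_seymour_any_type[OF _ assms(4)[OF that]] subgroup_is_comm_group[OF that]
    by (simp add: comm_group_def)
  \<comment> \<open>\<open>B\<close> is chosen closest to \<open>A\<close>; a second base with the
    same label in the minor will yield a closer one.\<close>
  obtain B where Bg: "B \<in> g_bases G \<I> l g"
    and min: "\<And>D. D \<in> g_bases G \<I> l g \<Longrightarrow> card (A - B) \<le> card (A - D)"
    using g ex_has_least_nat[of "\<lambda>B. B \<in> g_bases G \<I> l g" _ "\<lambda>B. card (A - B)"] by blast
  then have B: "B \<in> bases \<I>" and lB: "label G l B = g" by (auto simp: g_bases_def)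
  have fA: "finite A" and fB: "finite B" using A B finite_base by auto
  have AE: "A \<subseteq> E" and BE: "B \<subseteq> E" using A B base_subset_ground by auto
  have "card (A - B) \<le> order G - 1"
  proof (rule ccontr)
    assume "\<not> ?thesis"
    then have ord: "order G \<le> card (A - B)" by simp
    define C where "C = A \<inter> B"
    define S where "S = (A - B) \<union> (B - A)"
    have AC: "(A - B) \<union> C = A" and BC: "(B - A) \<union> C = B" by (auto simp: C_def)
    have disj: "S \<inter> C = {}" by (auto simp: C_def S_def)
    have AC': "(A - B) \<union> C \<in> bases \<I>" and BC': "(B - A) \<union> C \<in> bases \<I>"
      using A B AC BC by simp_all
    note N = minor_matroid_bases[OF M AC' BC', folded S_def, OF disj]
    interpret N: loopless_matroid S "minor \<I> S C" by (rule N(1))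
    have AN: "A - B \<in> bases (minor \<I> S C)" and BN: "B - A \<in> bases (minor \<I> S C)"
      using N(2) AC' BC' by (auto simp: S_def)
    have lS: "l \<in> S \<rightarrow> carrier G" using l AE BE by (auto simp: S_def)
    obtain D where D: "D \<in> bases (minor \<I> S C)" "D \<noteq> B - A"
      and lD: "label G l D = label G l (B - A)"
      using second_base_same_label[OF assms(1,2) SS N(1) AN BN S_def[symmetric] _ lS ord] by blast
    have D': "D \<subseteq> S" "D \<union> C \<in> bases \<I>" using D N(2) by auto
    have split: "label G l (X \<union> C) = label G l X \<otimes>\<^bsub>G\<^esub> label G l C" if X: "X \<subseteq> S" for X
      unfolding label_def
    proof (rule finprod_Un_disjoint)
      show "finite X" using X N.finite_ground finite_subset by blast
      show "finite C" using fB by (simp add: C_def)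
      show "X \<inter> C = {}" using X disj by blast
      show "l \<in> X \<rightarrow> carrier G" "l \<in> C \<rightarrow> carrier G" using X lS l AE by (auto simp: C_def)
    qed
    have "label G l (D \<union> C) = g"
      using split[OF D'(1)] split[of "B - A"] BC lB lD by (simp add: S_def)
    then have "card (A - B) \<le> card (A - (D \<union> C))" using min D' by (simp add: g_bases_def)
    moreover have "A - (D \<union> C) \<subset> A - B"
    proof -
      \<comment> \<open>\<open>D\<close> and \<open>B - A\<close> are distinct sets of equal size,
        so \<open>D\<close> must use an element of \<open>A - B\<close>. Since
        \<open>D \<union> C\<close> keeps all of \<open>A \<inter> B\<close>, it is strictly closer
        to \<open>A\<close>.\<close>
      have "\<not> D \<subseteq> B - A"
        using D(2) N.card_base[OF D(1)] N.card_base[OF BN] fB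
        by (metis card_subset_eq finite_Diff)
      then obtain d where "d \<in> D" "d \<in> A - B" using D'(1) by (auto simp: S_def)
      moreover have "A - (D \<union> C) \<subseteq> A - B" by (auto simp: C_def)
      ultimately show ?thesis by blast
    qed
    then have "card (A - (D \<union> C)) < card (A - B)" using fA by (simp add: psubset_card_mono)
    ultimately show False by simp
  qed
  then show "\<exists>B\<in>g_bases G \<I> l g. card (A - B) \<le> order G - 1" using Bg by blast
qed

end
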